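(* Let $n\ge2$ be an integer, $d_2=\gcd(2,n)$, $d_3=\gcd(3,n)$ and $d_4=\gcd(4,n)$. Then $$[\mathbb{D}_n^z]\circledcirc[\mathbb{O}\oplus\mathbb{Z}_2^c]=\{[\mathbb{1}],[\mathbb{Z}_{d_2}],[\mathbb{Z}_{d_3}],[\mathbb{Z}_{d_4}],[\mathbb{Z}_2^-],[\mathbb{D}_{d_2}^z],[\mathbb{D}_{d_3}^z],[\mathbb{D}_{d_4}^z]\}.$$
   Context: $[K]$ is the conjugacy class of a subgroup $K$ in $\mathrm{O}(3)$, and the clips operation is $[H_1]\circledcirc[H_2]=\{[H_1\cap gH_2g^{-1}]:g\in\mathrm{O}(3)\}$. $(e_1,e_2,e_3)$ is the canonical basis of $\mathbb{R}^3$, $\mathbf{r}(n,\theta)$ is the rotation by angle $\theta$ about the axis directed by $n\neq0$. $\mathbb{1}=\{\mathrm{Id}\}$; $\mathbb{Z}_2^c=\{\pm\mathrm{Id}\}$; $H\oplus\mathbb{Z}_2^c=H\cup(-H)$ for $H\subset\mathrm{SO}(3)$; $\mathbb{Z}_k=\{\mathbf{r}(e_3,2j\pi/k):0\le j\le k-1\}$; $\mathbb{Z}_2^-=\{\mathrm{Id},-\mathbf{r}(e_3,\pi)\}$; $\mathbb{D}_k^z=\mathbb{Z}_k\cup(-\mathbf{r}(e_1,\pi))\mathbb{Z}_k$ for $k\ge2$. $\mathbb{O}$ is the rotation group of the cube (order 24), generated by $\mathbf{r}(e_3,\pi/2),\mathbf{r}(e_1,\pi),\mathbf{r}(e_1+e_2+e_3,2\pi/3)$.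 Conventions: $[\mathbb{Z}_1]=[\mathbb{1}]$, $[\mathbb{D}_1^z]=[\mathbb{Z}_2^-]$. *)

theory Defs
  imports "HOL-Analysis.Analysis" "HOL-Algebra.Generated_Groups"
begin

type_synonym mat3 = "real^3^3"

definition O3 :: "mat3 monoid" where
  "O3 = \<lparr>carrier = {A. orthogonal_matrix A}, mult = (**), one = mat 1\<rparr>"

abbreviation e1 :: "real^3" where "e1 \<equiv> axis 1 1"
abbreviation e2 :: "real^3" where "e2 \<equiv> axis 2 1"
abbreviation e3 :: "real^3" where "e3 \<equiv> axis 3 1"

(* Rodrigues' formula for the right-handed rotation about the axis directed by n;
   n need not be a unit vector, sgn n = n / |n|, and only n \<noteq> 0 is meaningful. *)
definition rot :: "real^3 \<Rightarrow> real \<Rightarrow> mat3" where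
  "rot n \<theta> = matrix (\<lambda>x. cos \<theta> *\<^sub>R x + sin \<theta> *\<^sub>R cross3 (sgn n) x
                       + ((1 - cos \<theta>) * (sgn n \<bullet> x)) *\<^sub>R sgn n)"

definition conj_set :: "mat3 \<Rightarrow> mat3 set \<Rightarrow> mat3 set" where
  "conj_set g K = (\<lambda>A. g ** A ** matrix_inv g) ` K"

definition conj_class :: "mat3 set \<Rightarrow> mat3 set set" where
  "conj_class K = {conj_set g K | g. g \<in> carrier O3}"

(* An operation on conjugacy classes, so H1 and H2 range over all representatives;
   clips_conj_class shows that fixed representatives give the same set. *)
definition clips :: "mat3 set set \<Rightarrow> mat3 set set \<Rightarrow> mat3 set set set"
    (infixl "\<circledcirc>" 70) where
  "C1 \<circledcirc> C2 = {conj_class (H1 \<inter> conj_set g H2) | H1 H2 g.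
                 H1 \<in> C1 \<and> H2 \<in> C2 \<and> g \<in> carrier O3}"

definition trivial_grp :: "mat3 set" where
  "trivial_grp = {mat 1}"

(* The direct sum of H with {1, -1}, for H contained in SO(3). *)
definition plus_Z2c :: "mat3 set \<Rightarrow> mat3 set" where
  "plus_Z2c H = H \<union> uminus ` H"

definition Zk :: "nat \<Rightarrow> mat3 set" where
  "Zk k = {rot e3 (2 * real j * pi / real k) | j. j < k}"

definition Z2minus :: "mat3 set" where
  "Z2minus = {mat 1, - rot e3 pi}"

(* For k = 1 this is a group of order 2 generated by a reflection, conjugate to Z2minus:
   see conj_class_Dz_1. *)
definition Dz :: "nat \<Rightarrow> mat3 set" where
  "Dz k = Zk k \<union> (\<lambda>A. (- rot e1 pi) ** A) ` Zk k"

definition octahedral :: "mat3 set" where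
  "octahedral = generate O3 {rot e3 (pi / 2), rot e1 pi, rot (e1 + e2 + e3) (2 * pi / 3)}"

lemma matrix_inv_O3: "g \<in> carrier O3 \<Longrightarrow> matrix_inv g = transpose g"
proof -
  assume "g \<in> carrier O3"
  then have g: "g ** transpose g = mat 1 \<and> transpose g ** g = mat 1"
    by (simp add: O3_def orthogonal_matrix_def)
  then have "g ** matrix_inv g = mat 1 \<and> matrix_inv g ** g = mat 1"
    unfolding matrix_inv_def by (rule someI)
  with g show ?thesis by (metis matrix_mul_assoc matrix_mul_lid matrix_mul_rid)
qed

lemma group_O3: "group O3"
proof (rule groupI)
  fix x assume "x \<in> carrier O3"
  then show "\<exists>y\<in>carrier O3. y \<otimes>\<^bsub>O3\<^esub> x = \<one>\<^bsub>O3\<^esub>"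
    by (intro bexI[of _ "transpose x"]) (auto simp: O3_def orthogonal_matrix_def)
qed (auto simp: O3_def orthogonal_matrix_mul orthogonal_matrix_id matrix_mul_assoc)

lemma conj_set_mult:
  assumes "g \<in> carrier O3" "h \<in> carrier O3"
  shows "conj_set g (conj_set h K) = conj_set (g ** h) K"
proof -
  have "g ** h \<in> carrier O3" using assms by (auto simp: O3_def orthogonal_matrix_mul)
  then show ?thesis
    using assms
    by (simp add: conj_set_def image_image matrix_inv_O3 matrix_transpose_mul matrix_mul_assoc)
qed

lemma conj_set_id: "conj_set (mat 1) K = K"
proof -
  have "mat 1 \<in> carrier O3" by (simp add: O3_def orthogonal_matrix_id)
  then show ?thesis by (simp add: conj_set_def matrix_inv_O3)
qed

lemma transpose_O3:
  assumes "g \<in> carrier O3"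
  shows "transpose g \<in> carrier O3" "transpose g ** g = mat 1" "g ** transpose g = mat 1"
  using assms by (auto simp: O3_def orthogonal_matrix_def)

lemma conj_set_Int:
  assumes "g \<in> carrier O3"
  shows "conj_set g (A \<inter> B) = conj_set g A \<inter> conj_set g B"
proof -
  have "inj (\<lambda>A. g ** A ** matrix_inv g)"
  proof (rule inj_on_inverseI)
    fix A :: mat3
    show "transpose g ** (g ** A ** matrix_inv g) ** g = A"
      using transpose_O3[OF assms] assms
      by (metis matrix_inv_O3 matrix_mul_assoc matrix_mul_lid matrix_mul_rid)
  qed
  then show ?thesis by (simp add: conj_set_def image_Int)
qed

lemma conj_class_conj_set:
  assumes "g \<in> carrier O3"
  shows "conj_class (conj_set g K) = conj_class K"
proof -
  have mult: "a ** b \<in> carrier O3" if "a \<in> carrier O3" "b \<in> carrier O3" for a b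
    using that by (auto simp: O3_def orthogonal_matrix_mul)
  have "conj_class (conj_set g K) \<subseteq> conj_class K" if "g \<in> carrier O3" for g K
    using that mult by (auto simp: conj_class_def conj_set_mult)
  from this[OF assms, of K] this[OF transpose_O3(1)[OF assms], of "conj_set g K"]
  show ?thesis
    using assms by (simp add: conj_set_mult transpose_O3 conj_set_id)
qed

lemma clips_conj_class:
  "conj_class H1 \<circledcirc> conj_class H2
     = {conj_class (H1 \<inter> conj_set g H2) | g. g \<in> carrier O3}"
proof
  have one: "mat 1 \<in> carrier O3" by (simp add: O3_def orthogonal_matrix_id)
  have mult: "a ** b \<in> carrier O3" if "a \<in> carrier O3" "b \<in> carrier O3" for a b
    using that by (auto simp: O3_def orthogonal_matrix_mul)
  show "{conj_class (H1 \<inter> conj_set g H2) | g. g \<in> carrier O3} \<subseteq> conj_class H1 \<circledcirc> conj_class H2"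
  proof -
    have "H \<in> conj_class H" for H
      using one conj_set_id[of H] unfolding conj_class_def by force
    then show ?thesis unfolding clips_def by blast
  qed
  show "conj_class H1 \<circledcirc> conj_class H2 \<subseteq> {conj_class (H1 \<inter> conj_set g H2) | g. g \<in> carrier O3}"
  proof
    fix X assume "X \<in> conj_class H1 \<circledcirc> conj_class H2"
    then obtain a b g where abg: "a \<in> carrier O3" "b \<in> carrier O3" "g \<in> carrier O3"
      and X: "X = conj_class (conj_set a H1 \<inter> conj_set g (conj_set b H2))"
      unfolding clips_def conj_class_def[of H1] conj_class_def[of H2] by blast
    let ?h = "transpose a ** (g ** b)"
    have ta: "transpose a \<in> carrier O3" using abg transpose_O3 by blast
    have "X = conj_class (conj_set (transpose a) (conj_set a H1 \<inter> conj_set g (conj_set b H2)))"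
      using X conj_class_conj_set[OF ta] by simp
    also have "\<dots> = conj_class (H1 \<inter> conj_set ?h H2)"
      using abg ta mult
      by (simp add: conj_set_Int conj_set_mult transpose_O3 conj_set_id)
    finally show "X \<in> {conj_class (H1 \<inter> conj_set g H2) | g. g \<in> carrier O3}"
      using mult ta abg by blast
  qed
qed

lemma rot_e3:
  "rot e3 \<theta> = vector [vector [cos \<theta>, - sin \<theta>, 0], vector [sin \<theta>, cos \<theta>, 0], vector [0, 0, 1]]"
proof -
  have "sgn e3 = e3" by (simp add: sgn_div_norm)
  then show ?thesis
    by (simp add: rot_def matrix_def vec_eq_iff forall_3 cross3_def axis_def vector_3
        inner_vec_def sum_3)
qed

lemma rot_e1:
  "rot e1 \<theta> = vector [vector [1, 0, 0], vector [0, cos \<theta>, - sin \<theta>], vector [0, sin \<theta>, cos \<theta>]]"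
proof -
  have "sgn e1 = e1" by (simp add: sgn_div_norm)
  then show ?thesis
    by (simp add: rot_def matrix_def vec_eq_iff forall_3 cross3_def axis_def vector_3
        inner_vec_def sum_3)
qed

lemma rot_111:
  "rot (e1 + e2 + e3) (2 * pi / 3) = vector [vector [0, 0, 1], vector [1, 0, 0], vector [0, 1, 0]]"
proof -
  define r where "r = inverse (sqrt 3)"
  have r: "3 * r * r = 1" "r * r = 1 / 3" "sqrt 3 * r = 1"
    by (simp_all add: r_def mult.assoc flip: inverse_mult_distrib)
  have n: "norm (e1 + e2 + e3) = sqrt 3"
    by (simp add: norm_vec_def L2_set_def sum_3 axis_def)
  have s: "sgn (e1 + e2 + e3) = vector [r, r, r]"
    unfolding sgn_div_norm n r_def[symmetric] by (simp add: vec_eq_iff forall_3 axis_def vector_3)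
  have cs: "cos (2 * pi / 3) = - 1 / 2" "sin (2 * pi / 3) = sqrt 3 / 2"
    using cos_120 sin_120 by auto
  show ?thesis
    unfolding rot_def s cs
    by (simp add: matrix_def vec_eq_iff forall_3 cross3_def axis_def vector_3
        inner_vec_def sum_3 r)
qed

lemma Zk_1: "Zk 1 = trivial_grp"
  by (auto simp: Zk_def trivial_grp_def rot_e3 mat_def vec_eq_iff forall_3 vector_3)

lemma conj_class_Dz_1: "conj_class (Dz 1) = conj_class Z2minus"
proof -
  let ?g = "vector [vector [0, 0, 1], vector [1, 0, 0], vector [0, 1, 0]] :: mat3"
  have g: "?g \<in> carrier O3"
    by (simp add: O3_def orthogonal_matrix_def matrix_matrix_mult_def transpose_def mat_def
        vec_eq_iff forall_3 sum_3 vector_3)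
  have "?g ** (- rot e3 pi) ** transpose ?g = - rot e1 pi"
    by (simp add: rot_e3 rot_e1 matrix_matrix_mult_def transpose_def
        vec_eq_iff forall_3 sum_3 vector_3)
  then have "conj_set ?g Z2minus = Dz 1"
    unfolding Dz_def Zk_1 trivial_grp_def Z2minus_def conj_set_def
    using transpose_O3[OF g] by (auto simp: matrix_inv_O3[OF g])
  then show ?thesis using conj_class_conj_set[OF g] by metis
qed

end

theory Submission
  imports Defs
begin

text \<open>
  Write B for the full octahedral group and L for a conjugate of B.  The class of the
  intersection of \<^term>\<open>Dz n\<close> with L depends on two questions only: which rotations about the
  vertical axis lie in L, and whether one of the vertical mirrors of \<^term>\<open>Dz n\<close> does.

  The rotations in the intersection form a subgroup of the cyclic group \<^term>\<open>Zk n\<close>, hence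
  \<^term>\<open>Zk d\<close> for a divisor d of n.  The matrices of B have integer entries, so the trace of
  an element of L is an integer, and it is never 2.  The trace of a rotation through 2 pi / d lies
  strictly between 1 and 3 for d at least 5, so d is at most 4
  (\<open>rot_e3_order_in_conj_Oh\<close>).  As d divides n, it is gcd d n.  If the
  intersection contains no mirror, it is \<^term>\<open>Zk d\<close>.  If it contains one, that mirror generates
  the remaining coset, and turning it into the standard position shows that the intersection is
  conjugate to \<^term>\<open>Dz d\<close> (\<open>Dz_Int_subgroup_cases\<close>).  So every class in the clips is that of
  \<^term>\<open>Zk (gcd f n)\<close> or \<^term>\<open>Dz (gcd f n)\<close> with f between 1 and 4.

  Conversely, for each such f the cube can be placed so that the vertical line is an axis of order
  f (no axis at all if f = 1) lying in a mirror plane of the cube, and so that this plane is also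
  the one of the reflection - \<^term>\<open>rot e1 pi\<close> in \<^term>\<open>Dz n\<close>.  The intersection is then \<^term>\<open>Dz (gcd f n)\<close>
  (\<open>Dz_Int_conj_Oh_realised\<close>).  Turning this cube about the vertical axis does not change which
  vertical rotations it admits, but by a generic angle it separates its finitely many mirrors from
  those of \<^term>\<open>Dz n\<close>, which leaves \<^term>\<open>Zk (gcd f n)\<close> (\<open>Dz_Int_turned_subgroup\<close>).
\<close>

section \<open>Rotations about the vertical axis and vertical mirrors\<close>

lemma rot_e3_0: "rot e3 0 = mat 1"
  by (simp add: rot_e3 mat_def vec_eq_iff forall_3)

lemma rot_e3_mult: "rot e3 a ** rot e3 b = rot e3 (a + b)"
  by (simp add: rot_e3 matrix_matrix_mult_def vec_eq_iff forall_3 sum_3 cos_add sin_add)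

lemma transpose_rot_e3: "transpose (rot e3 a) = rot e3 (- a)"
  by (simp add: rot_e3 transpose_def vec_eq_iff forall_3)

lemma rot_e3_carrier: "rot e3 a \<in> carrier O3"
  by (simp add: O3_def orthogonal_matrix_def transpose_rot_e3 rot_e3_mult rot_e3_0)

lemma rot_e3_eq_iff: "rot e3 a = rot e3 b \<longleftrightarrow> (\<exists>i::int. a = b + 2 * pi * i)"
proof -
  have "rot e3 a = rot e3 b \<longleftrightarrow> sin a = sin b \<and> cos a = cos b"
    by (auto simp: rot_e3 vec_eq_iff forall_3)
  then show ?thesis by (simp add: sin_cos_eq_iff mult.assoc mult.commute mult.left_commute)
qed

lemma rot_e3_2pi: "rot e3 (2 * pi) = mat 1"
  by (simp add: rot_e3 mat_def vec_eq_iff forall_3)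

text \<open>The reflection in the vertical plane with normal (cos (\<theta>/2), - sin (\<theta>/2), 0).\<close>

definition mirror :: "real \<Rightarrow> mat3" where
  "mirror \<theta> = (- rot e1 pi) ** rot e3 \<theta>"

lemma mirror_matrix:
  "mirror \<theta> = vector [vector [- cos \<theta>, sin \<theta>, 0], vector [sin \<theta>, cos \<theta>, 0], vector [0, 0, 1]]"
  by (simp add: mirror_def rot_e3 rot_e1 matrix_matrix_mult_def vec_eq_iff forall_3 sum_3)

lemma mirror_0: "mirror 0 = - rot e1 pi"
  by (simp add: mirror_def rot_e3_0)

lemma mirror_mult_rot_e3: "mirror a ** rot e3 b = mirror (a + b)"
  by (simp add: mirror_def rot_e3_mult flip: matrix_mul_assoc)

lemma mirror_mult_mirror: "mirror a ** mirror b = rot e3 (b - a)"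
  by (simp add: mirror_matrix rot_e3 matrix_matrix_mult_def vec_eq_iff forall_3 sum_3
      cos_diff sin_diff)

lemma rot_e3_conj_mirror: "rot e3 a ** mirror b ** rot e3 (- a) = mirror (b - 2 * a)"
proof -
  have "rot e3 a ** mirror b = mirror (b - a)"
    by (simp add: mirror_matrix rot_e3 matrix_matrix_mult_def vec_eq_iff forall_3 sum_3
        cos_diff sin_diff)
  then show ?thesis by (simp add: mirror_mult_rot_e3)
qed

lemma Dz_altdef: "Dz k = Zk k \<union> {mirror (2 * real j * pi / real k) | j. j < k}"
  by (auto simp: Dz_def Zk_def mirror_def)

section \<open>Subgroups of O(3)\<close>

lemma subgroup_O3_iff:
  "subgroup L O3 \<longleftrightarrow> L \<subseteq> carrier O3 \<and> mat 1 \<in> L \<and>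
     (\<forall>A\<in>L. \<forall>B\<in>L. A ** B \<in> L) \<and> (\<forall>A\<in>L. transpose A \<in> L)"
proof -
  interpret group O3 by (rule group_O3)
  have inv: "inv\<^bsub>O3\<^esub> A = transpose A" if "A \<in> carrier O3" for A
    using that transpose_O3[OF that] by (intro inv_equality) (auto simp: O3_def)
  show ?thesis
  proof
    assume L: "subgroup L O3"
    have "transpose A \<in> L" if "A \<in> L" for A
      using subgroup.m_inv_closed[OF L that] inv subgroup.mem_carrier[OF L that] by simp
    then show "L \<subseteq> carrier O3 \<and> mat 1 \<in> L \<and>
     (\<forall>A\<in>L. \<forall>B\<in>L. A ** B \<in> L) \<and> (\<forall>A\<in>L. transpose A \<in> L)"
      using subgroup.subset[OF L] subgroup.one_closed[OF L] subgroup.m_closed[OF L]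
      by (auto simp: O3_def)
  next
    assume "L \<subseteq> carrier O3 \<and> mat 1 \<in> L \<and>
     (\<forall>A\<in>L. \<forall>B\<in>L. A ** B \<in> L) \<and> (\<forall>A\<in>L. transpose A \<in> L)"
    then show "subgroup L O3"
      using inv by (intro subgroup.intro) (auto simp: O3_def subset_iff)
  qed
qed

lemma mem_conj_set_iff:
  assumes "g \<in> carrier O3"
  shows "A \<in> conj_set g K \<longleftrightarrow> transpose g ** A ** g \<in> K"
proof -
  have "transpose g ** (g ** B ** transpose g) ** g = B"
    "g ** (transpose g ** B ** g) ** transpose g = B" for B
    using transpose_O3[OF assms] by (metis matrix_mul_assoc matrix_mul_lid matrix_mul_rid)+
  then show ?thesis
    unfolding conj_set_def matrix_inv_O3[OF assms] image_iff by metis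
qed

lemma subgroup_conj_set:
  assumes g: "g \<in> carrier O3" and L: "subgroup L O3"
  shows "subgroup (conj_set g L) O3"
  unfolding subgroup_O3_iff
proof (intro conjI ballI subsetI)
  have mult: "a ** b \<in> carrier O3" if "a \<in> carrier O3" "b \<in> carrier O3" for a b
    using that by (auto simp: O3_def orthogonal_matrix_mul)
  note L' = L[unfolded subgroup_O3_iff]
  show "A \<in> carrier O3" if "A \<in> conj_set g L" for A
    using that L' g unfolding conj_set_def matrix_inv_O3[OF g]
    by (auto intro!: mult transpose_O3)
  show "mat 1 \<in> conj_set g L"
    using L' by (simp add: mem_conj_set_iff[OF g] transpose_O3[OF g])
  show "A ** B \<in> conj_set g L" if "A \<in> conj_set g L" "B \<in> conj_set g L" for A B
  proof -
    have "(transpose g ** A ** g) ** (transpose g ** B ** g)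
        = transpose g ** A ** (g ** transpose g) ** B ** g"
      by (simp only: matrix_mul_assoc)
    also have "\<dots> = transpose g ** (A ** B) ** g"
      by (simp only: transpose_O3(3)[OF g] matrix_mul_rid) (simp only: matrix_mul_assoc)
    finally have "transpose g ** (A ** B) ** g
        = (transpose g ** A ** g) ** (transpose g ** B ** g)" by (rule sym)
    then show ?thesis using that L' by (simp add: mem_conj_set_iff[OF g])
  qed
  show "transpose A \<in> conj_set g L" if "A \<in> conj_set g L" for A
  proof -
    have "transpose g ** transpose A ** g = transpose (transpose g ** A ** g)"
      by (simp add: matrix_transpose_mul matrix_mul_assoc)
    then show ?thesis using that L' by (simp add: mem_conj_set_iff[OF g])
  qed
qed

section \<open>Intersections with a subgroup of O(3)\<close>

text \<open>This is the subgroup structure of a cyclic group of order n: if m is the least positive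
  index of a rotation of L, the indices occurring in L are the multiples of m, and
  d = n / m.\<close>

lemma Zk_Int_subgroup:
  assumes L: "subgroup L O3" and n: "n > 0"
  obtains d where "d dvd n" "d > 0" "Zk n \<inter> L = Zk d"
proof -
  note L' = L[unfolded subgroup_O3_iff]
  define r where "r j = rot e3 (2 * real j * pi / real n)" for j :: nat
  have add: "r (i + j) = r i ** r j" for i j
    by (simp add: r_def rot_e3_mult add_divide_distrib distrib_left distrib_right)
  have inv: "r i ** transpose (r i) = mat 1" "transpose (r i) ** r i = mat 1" for i
    using transpose_O3[OF rot_e3_carrier] by (auto simp: r_def)
  define m where "m = (LEAST m. m > 0 \<and> r m \<in> L)"
  have "r n = mat 1" using n by (simp add: r_def rot_e3_2pi)
  then have "n > 0 \<and> r n \<in> L" using n L' by simp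
  then have m: "m > 0" "r m \<in> L" unfolding m_def by (metis (mono_tags, lifting) LeastI)+
  have least: "m \<le> j" if "j > 0" "r j \<in> L" for j
    unfolding m_def using that by (intro Least_le) auto
  have dvd: "m dvd j" if "r j \<in> L" for j
    using that
  proof (induction j rule: less_induct)
    case (less j)
    show ?case
    proof (cases "j = 0")
      case False
      with least less have le: "m \<le> j" by auto
      then have "r j = r (j - m) ** r m" by (metis add le_add_diff_inverse2)
      then have "r (j - m) = r j ** transpose (r m)"
        by (metis inv(1) matrix_mul_assoc matrix_mul_rid)
      then have "r (j - m) \<in> L" using L' m less by auto
      then have "m dvd j - m" using less.IH[of "j - m"] m False by auto
      then show ?thesis using le by (auto simp: dvd_minus_self)
    qed auto
  qed
  have mult: "r (m * i) \<in> L" for i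
  proof (induction i)
    case 0
    show ?case using L' by (simp add: r_def rot_e3_0)
  next
    case (Suc i)
    then show ?case using L' m by (simp add: add)
  qed
  obtain d where d: "n = m * d" using dvd \<open>n > 0 \<and> r n \<in> L\<close> by blast
  have d0: "d > 0" using n d by (cases d) auto
  have r_m: "r (m * i) = rot e3 (2 * real i * pi / real d)" for i
    using m d0 unfolding r_def d by (intro arg_cong[of _ _ "rot e3"]) (simp add: field_simps)
  have "Zk n \<inter> L = {r j | j. j < n \<and> r j \<in> L}" by (auto simp: Zk_def r_def)
  also have "\<dots> = {r (m * i) | i. i < d}"
  proof (intro equalityI subsetI)
    fix x assume "x \<in> {r j | j. j < n \<and> r j \<in> L}"
    then obtain j where j: "x = r j" "j < n" "r j \<in> L" by auto
    then obtain i where "j = m * i" using dvd by blast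
    then show "x \<in> {r (m * i) | i. i < d}" using j d m by auto
  next
    fix x assume "x \<in> {r (m * i) | i. i < d}"
    then show "x \<in> {r j | j. j < n \<and> r j \<in> L}" using mult d m by auto
  qed
  also have "\<dots> = Zk d" by (simp add: r_m Zk_def)
  finally have "Zk n \<inter> L = Zk d" .
  moreover have "d dvd n" by (simp add: d)
  ultimately show ?thesis using that d0 by blast
qed

lemma Zk_eq_range:
  assumes "k > 0"
  shows "Zk k = range (\<lambda>i::int. rot e3 (2 * of_int i * pi / real k))"
proof (intro equalityI subsetI)
  fix x assume "x \<in> Zk k"
  then obtain j where "x = rot e3 (2 * real j * pi / real k)" by (auto simp: Zk_def)
  then have "x = rot e3 (2 * of_int (int j) * pi / real k)" by simp
  then show "x \<in> range (\<lambda>i::int. rot e3 (2 * of_int i * pi / real k))" by blast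
next
  fix x assume "x \<in> range (\<lambda>i::int. rot e3 (2 * of_int i * pi / real k))"
  then obtain i :: int where x: "x = rot e3 (2 * of_int i * pi / real k)" by blast
  define q j where "q = i div int k" and "j = nat (i mod int k)"
  have j: "j < k" "i = int j + int k * q" using assms by (auto simp: j_def q_def nat_less_iff)
  then have "x = rot e3 (2 * real j * pi / real k)"
    unfolding x rot_e3_eq_iff using assms by (intro exI[of _ q]) (simp add: field_simps)
  then show "x \<in> Zk k" using j by (auto simp: Zk_def)
qed

lemma rot_e3_in_Zk: "k > 0 \<Longrightarrow> rot e3 (2 * pi / real k) \<in> Zk k"
  unfolding Zk_eq_range by (rule range_eqI[of _ _ 1]) simp

lemma Zk_mono:
  assumes "d dvd n" "n > 0"
  shows "Zk d \<subseteq> Zk n"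
proof -
  obtain m where m: "n = d * m" using assms by blast
  then have pos: "d > 0" "m > 0" using assms by auto
  have "rot e3 (2 * of_int i * pi / real d) \<in> Zk n" for i :: int
  proof -
    have "rot e3 (2 * of_int i * pi / real d) = rot e3 (2 * of_int (i * int m) * pi / real n)"
      using pos by (intro arg_cong[of _ _ "rot e3"]) (simp add: m field_simps)
    then show ?thesis unfolding Zk_eq_range[OF assms(2)] by blast
  qed
  then show ?thesis using Zk_eq_range[OF pos(1)] by auto
qed

lemma rot_e3_in_Zk_imp_dvd:
  assumes "rot e3 (2 * pi / real k) \<in> Zk d" "k > 0" "d > 0"
  shows "k dvd d"
proof -
  obtain i :: int where "rot e3 (2 * pi / real k) = rot e3 (2 * of_int i * pi / real d)"
    using assms by (auto simp: Zk_eq_range)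
  then obtain q :: int where "2 * pi / real k = 2 * of_int i * pi / real d + 2 * pi * of_int q"
    by (auto simp: rot_e3_eq_iff)
  then have "2 * pi * real d = 2 * pi * (real k * (of_int i + of_int q * real d))"
    using assms by (simp add: field_simps)
  then have "real d = real k * (of_int i + of_int q * real d)"
    by (simp only: mult_cancel_left) simp
  then have "real_of_int (int d) = of_int (int k * (i + q * int d))" by simp
  then have "int d = int k * (i + q * int d)" by (simp only: of_int_eq_iff)
  then show ?thesis by (metis dvd_triv_left int_dvd_int_iff)
qed

lemma Zk_subset_subgroup:
  assumes L: "subgroup L O3" and "rot e3 (2 * pi / real k) \<in> L"
  shows "Zk k \<subseteq> L"
proof -
  note L' = L[unfolded subgroup_O3_iff]
  have "rot e3 (2 * real j * pi / real k) \<in> L" for j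
  proof (induction j)
    case 0
    show ?case using L' by (simp add: rot_e3_0)
  next
    case (Suc j)
    have "rot e3 (2 * real (Suc j) * pi / real k)
      = rot e3 (2 * real j * pi / real k) ** rot e3 (2 * pi / real k)"
      by (simp add: rot_e3_mult add_divide_distrib distrib_left distrib_right add.commute)
    then show ?case using L' Suc assms by auto
  qed
  then show ?thesis by (auto simp: Zk_def)
qed

text \<open>A mirror in the intersection is a coset representative: it generates, together with the
  rotations, everything else, because the product of two mirrors is a rotation of both groups.\<close>

lemma Dz_Int_subgroup_with_mirror:
  assumes L: "subgroup L O3" and n: "n > 0" and Z: "Zk n \<inter> L = Zk d"
    and j: "j < n" and x: "x = 2 * real j * pi / real n" and mir: "mirror x \<in> L"
  shows "Dz n \<inter> L = Zk d \<union> (\<lambda>A. mirror x ** A) ` Zk d"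
proof -
  note L' = L[unfolded subgroup_O3_iff]
  define M where "M = {mirror (2 * real i * pi / real n) | i. i < n}"
  have "M \<inter> L = (\<lambda>A. mirror x ** A) ` Zk d"
  proof (intro equalityI subsetI)
    fix A assume "A \<in> M \<inter> L"
    then obtain i where i: "A = mirror (2 * real i * pi / real n)" "A \<in> L"
      by (auto simp: M_def)
    define y where "y = 2 * of_int (int i - int j) * pi / real n"
    have y: "x + y = 2 * real i * pi / real n"
      by (simp add: y_def x algebra_simps flip: add_divide_distrib)
    then have "mirror x ** A = rot e3 y" by (simp add: i mirror_mult_mirror flip: y)
    then have "rot e3 y \<in> L" using L' mir i by metis
    moreover have "rot e3 y \<in> Zk n" unfolding Zk_eq_range[OF n] y_def by blast
    ultimately have "rot e3 y \<in> Zk d" using Z by blast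
    moreover have "A = mirror x ** rot e3 y" by (simp add: i mirror_mult_rot_e3 y)
    ultimately show "A \<in> (\<lambda>A. mirror x ** A) ` Zk d" by blast
  next
    fix A assume "A \<in> (\<lambda>A. mirror x ** A) ` Zk d"
    then obtain B where B: "A = mirror x ** B" "B \<in> Zk n" "B \<in> L" using Z by blast
    then obtain i where i: "B = rot e3 (2 * real i * pi / real n)" by (auto simp: Zk_def)
    have "rot e3 (2 * of_int (int i + int j) * pi / real n) \<in> Zk n"
      unfolding Zk_eq_range[OF n] by blast
    then obtain l where l: "l < n"
      "rot e3 (2 * of_int (int i + int j) * pi / real n) = rot e3 (2 * real l * pi / real n)"
      by (auto simp: Zk_def)
    have "A = mirror (2 * of_int (int i + int j) * pi / real n)"
      by (simp add: B i x mirror_mult_rot_e3 distrib_left distrib_right add_divide_distrib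
          add.commute)
    also have "\<dots> = mirror (2 * real l * pi / real n)" by (simp only: mirror_def l)
    finally have "A \<in> M" using l by (auto simp: M_def)
    then show "A \<in> M \<inter> L" using B L' mir by auto
  qed
  then show ?thesis using Z by (auto simp: Dz_altdef M_def)
qed

lemma Dz_Int_subgroup_cases:
  assumes L: "subgroup L O3" and n: "n > 0" and Z: "Zk n \<inter> L = Zk d"
  shows "Dz n \<inter> L = Zk d \<or> (\<exists>a. Dz n \<inter> L = conj_set (rot e3 a) (Dz d))"
proof (cases "\<exists>j<n. mirror (2 * real j * pi / real n) \<in> L")
  case False
  then have "Dz n \<inter> L = Zk n \<inter> L" by (auto simp: Dz_altdef)
  with Z show ?thesis by simp
next
  case True
  then obtain j where j: "j < n" "mirror (2 * real j * pi / real n) \<in> L" by blast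
  define x where "x = 2 * real j * pi / real n"
  \<comment> \<open>Conjugating by a rotation through a lowers the parameter of a mirror by 2 a.\<close>
  define a where "a = - x / 2"
  have 1: "rot e3 a ** rot e3 y ** rot e3 (- a) = rot e3 y" for y
    by (simp add: rot_e3_mult)
  have 2: "rot e3 a ** mirror y ** rot e3 (- a) = mirror x ** rot e3 y" for y
    using rot_e3_conj_mirror[of a y] by (simp add: mirror_mult_rot_e3 a_def add.commute)
  have Zk_image: "Zk d = (\<lambda>i. rot e3 (2 * real i * pi / real d)) ` {..<d}"
    by (auto simp: Zk_def)
  have "Dz d = Zk d \<union> (\<lambda>i. mirror (2 * real i * pi / real d)) ` {..<d}"
    by (auto simp: Dz_altdef)
  then have "conj_set (rot e3 a) (Dz d) = Zk d \<union> (\<lambda>A. mirror x ** A) ` Zk d"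
    unfolding conj_set_def matrix_inv_O3[OF rot_e3_carrier] transpose_rot_e3 Zk_image
    by (simp only: image_Un image_image 1 2)
  with Dz_Int_subgroup_with_mirror[OF L n Z j(1) x_def] j(2) show ?thesis
    unfolding x_def by blast
qed

text \<open>Only finitely many mirrors of L have to be avoided, while the turning angle varies in an
  interval; the rotations about the vertical axis commute with the turning.\<close>

lemma Dz_Int_turned_subgroup:
  assumes fin: "finite L" and n: "n > 0"
  obtains a where "Dz n \<inter> conj_set (rot e3 a) L = Zk n \<inter> L"
proof -
  define t where "t j = 2 * real j * pi / real n" for j :: nat
  define X where "X = {x \<in> {0..<2 * pi}. mirror x \<in> L}"
  define bad where "bad = (\<Union>j<n. (\<lambda>x. x - t j) ` X)"
  have "inj_on mirror {0..<2 * pi}"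
  proof (rule inj_onI)
    fix x y assume xy: "x \<in> {0..<2 * pi}" "y \<in> {0..<2 * pi}" and "mirror x = mirror y"
    then have "cos x = cos y" "sin x = sin y"
      by (auto simp: mirror_matrix vec_eq_iff forall_3)
    then obtain q :: int where q: "x = y + 2 * pi * q"
      using sin_cos_eq_iff[of x y] by (auto simp: mult_ac)
    with xy have "2 * pi * q < 2 * pi * 1" "2 * pi * (- 1) < 2 * pi * q"
      unfolding atLeastLessThan_iff by linarith+
    then have "real_of_int q < 1" "- 1 < real_of_int q"
      using mult_less_cancel_left_pos[of "2 * pi"] pi_gt_zero by fastforce+
    then have "q = 0" by linarith
    with q show "x = y" by simp
  qed
  then have "finite X" unfolding X_def
    using finite_vimage_IntI[OF fin, of mirror "{0..<2 * pi}"]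
    by (simp add: Int_def vimage_def conj_commute)
  then have "finite bad" by (simp add: bad_def)
  moreover have "infinite {0<..<2 * pi / real n}" using n by simp
  \<comment> \<open>For b below 2 pi / n all parameters t j + b stay below 2 pi, where the parameter is
    determined by the mirror.\<close>
  ultimately obtain b where b: "b \<in> {0<..<2 * pi / real n}" "b \<notin> bad"
    by (meson finite_subset subsetI)
  define a where "a = b / 2"
  note mem = mem_conj_set_iff[OF rot_e3_carrier, of _ a L]
  have Z: "Zk n \<inter> conj_set (rot e3 a) L = Zk n \<inter> L"
    by (auto simp: mem Zk_def transpose_rot_e3 rot_e3_mult)
  have "mirror (t j) \<notin> conj_set (rot e3 a) L" if j: "j < n" for j
  proof
    assume "mirror (t j) \<in> conj_set (rot e3 a) L"
    then have "mirror (t j + b) \<in> L"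
      using rot_e3_conj_mirror[of "- a" "t j"]
      by (simp add: mem[unfolded a_def] transpose_rot_e3 a_def)
    moreover have "t j + b \<in> {0..<2 * pi}"
    proof -
      have "t j + 2 * pi / real n = 2 * pi * (real j + 1) / real n"
        by (simp add: t_def algebra_simps flip: add_divide_distrib)
      also have "\<dots> \<le> 2 * pi"
      proof -
        have "real j + 1 \<le> real n" using j by simp
        then have "2 * pi * (real j + 1) \<le> 2 * pi * real n" by (intro mult_left_mono) auto
        then show ?thesis using n by (simp add: divide_le_eq)
      qed
      finally show ?thesis using b by (auto simp: t_def)
    qed
    ultimately have "b \<in> bad" using j by (force simp: bad_def X_def)
    with b show False by simp
  qed
  then have "Dz n \<inter> conj_set (rot e3 a) L = Zk n \<inter> L"
    using Z unfolding Dz_altdef t_def by blast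
  then show ?thesis by (rule that)
qed

section \<open>The full octahedral group\<close>

definition integral_orthogonal :: "mat3 set" where
  "integral_orthogonal = {A \<in> carrier O3. \<forall>i j. A $ i $ j \<in> \<int>}"

lemma octahedral_gens_carrier:
  "{rot e3 (pi / 2), rot e1 pi, rot (e1 + e2 + e3) (2 * pi / 3)} \<subseteq> carrier O3"
  unfolding rot_e3 rot_e1 rot_111
  by (simp add: O3_def orthogonal_matrix_def matrix_matrix_mult_def transpose_def mat_def
      vec_eq_iff forall_3 sum_3)

lemma subgroup_octahedral: "subgroup octahedral O3"
  unfolding octahedral_def
  by (rule group.generate_is_subgroup[OF group_O3 octahedral_gens_carrier])

lemma subgroup_integral_orthogonal: "subgroup integral_orthogonal O3"
  unfolding subgroup_O3_iff
proof (intro conjI ballI)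
  show "A ** B \<in> integral_orthogonal"
    if "A \<in> integral_orthogonal" "B \<in> integral_orthogonal" for A B
  proof -
    have "orthogonal_matrix (A ** B)"
      using that by (simp add: integral_orthogonal_def O3_def orthogonal_matrix_mul)
    moreover have "(A ** B) $ i $ j \<in> \<int>" for i j
      using that by (auto simp: integral_orthogonal_def matrix_matrix_mult_def
          intro!: Ints_sum Ints_mult)
    ultimately show ?thesis by (simp add: integral_orthogonal_def O3_def)
  qed
next
  show "mat 1 \<in> integral_orthogonal"
    unfolding integral_orthogonal_def O3_def by (simp add: orthogonal_matrix_id) (simp add: mat_def)
  show "transpose A \<in> integral_orthogonal" if "A \<in> integral_orthogonal" for A
    using that unfolding integral_orthogonal_def O3_def by simp (simp add: transpose_def)
qed (auto simp: integral_orthogonal_def)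

lemma matrix_neg_left: "(- A) ** B = - (A ** (B :: mat3))"
  by (simp add: matrix_matrix_mult_def vec_eq_iff sum_negf)

lemma matrix_neg_right: "A ** (- B) = - (A ** (B :: mat3))"
  by (simp add: matrix_matrix_mult_def vec_eq_iff sum_negf)

lemma transpose_neg: "transpose (- A) = - transpose (A :: mat3)"
  by (simp add: transpose_def vec_eq_iff)

lemma subgroup_plus_Z2c:
  assumes "subgroup H O3"
  shows "subgroup (plus_Z2c H) O3"
proof -
  note H = assms[unfolded subgroup_O3_iff]
  have "- A \<in> carrier O3" if "A \<in> H" for A
    using that H by (auto simp: O3_def orthogonal_matrix_def matrix_neg_left matrix_neg_right
        transpose_neg)
  then show ?thesis
    unfolding subgroup_O3_iff plus_Z2c_def using H
    by (auto simp: matrix_neg_left matrix_neg_right transpose_neg)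
qed

lemmas subgroup_Oh = subgroup_plus_Z2c[OF subgroup_octahedral]

lemma octahedral_integral: "octahedral \<subseteq> integral_orthogonal"
  unfolding octahedral_def
proof (rule group.generate_subgroup_incl[OF group_O3 _ subgroup_integral_orthogonal])
  have "rot e3 (pi / 2) $ i $ j \<in> \<int> \<and> rot e1 pi $ i $ j \<in> \<int> \<and>
      rot (e1 + e2 + e3) (2 * pi / 3) $ i $ j \<in> \<int>" for i j
    unfolding rot_e3 rot_e1 rot_111 using exhaust_3[of i] exhaust_3[of j] by auto
  then show "{rot e3 (pi / 2), rot e1 pi, rot (e1 + e2 + e3) (2 * pi / 3)}
      \<subseteq> integral_orthogonal"
    using octahedral_gens_carrier by (auto simp: integral_orthogonal_def)
qed

lemma Oh_integral: "plus_Z2c octahedral \<subseteq> integral_orthogonal"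
proof -
  have "- A \<in> integral_orthogonal" if "A \<in> integral_orthogonal" for A
    using that by (auto simp: integral_orthogonal_def O3_def orthogonal_matrix_def
        matrix_neg_left matrix_neg_right transpose_neg)
  then show ?thesis using octahedral_integral by (auto simp: plus_Z2c_def)
qed

lemma orthogonal_matrix_row_col:
  fixes A :: mat3
  assumes "A \<in> carrier O3"
  shows "(A$i$1)\<^sup>2 + (A$i$2)\<^sup>2 + (A$i$3)\<^sup>2 = 1" "(A$1$i)\<^sup>2 + (A$2$i)\<^sup>2 + (A$3$i)\<^sup>2 = 1"
proof -
  have "(A ** transpose A) $ i $ i = 1" "(transpose A ** A) $ i $ i = 1"
    using assms by (auto simp: O3_def orthogonal_matrix_def mat_def)
  then show "(A$i$1)\<^sup>2 + (A$i$2)\<^sup>2 + (A$i$3)\<^sup>2 = 1" "(A$1$i)\<^sup>2 + (A$2$i)\<^sup>2 + (A$3$i)\<^sup>2 = 1"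
    by (simp_all add: matrix_matrix_mult_def transpose_def sum_3 power2_eq_square)
qed

lemma integral_orthogonal_entries:
  assumes "A \<in> integral_orthogonal"
  shows "A $ i $ j \<in> {-1, 0, 1}"
proof -
  obtain k :: int where k: "A $ i $ j = of_int k"
    using assms by (auto simp: integral_orthogonal_def elim!: Ints_cases)
  have "(A$i$1)\<^sup>2 + (A$i$2)\<^sup>2 + (A$i$3)\<^sup>2 = 1"
    using assms orthogonal_matrix_row_col by (auto simp: integral_orthogonal_def)
  then have "(A$i$j)\<^sup>2 \<le> 1"
    using exhaust_3[of j] zero_le_power2[of "A$i$1"] zero_le_power2[of "A$i$2"]
      zero_le_power2[of "A$i$3"] by (elim disjE; simp; linarith)
  then have "\<bar>real_of_int k\<bar> \<le> 1" unfolding k by (simp add: abs_square_le_1)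
  then have "\<bar>k\<bar> \<le> 1" by linarith
  then have "k = -1 \<or> k = 0 \<or> k = 1" by arith
  then show ?thesis using k by auto
qed

lemma finite_integral_orthogonal: "finite integral_orthogonal"
proof -
  define V where "V = (\<lambda>(a, b, c). vector [a, b, c] :: real^3) `
    ({-1, 0, 1} \<times> {-1, 0, 1} \<times> {-1, 0, 1})"
  define W where "W = (\<lambda>(a, b, c). vector [a, b, c] :: mat3) ` (V \<times> V \<times> V)"
  have "finite W" unfolding W_def V_def by (intro finite_imageI finite_cartesian_product) auto
  moreover have "A \<in> W" if "A \<in> integral_orthogonal" for A
  proof -
    have "A $ i \<in> V" for i
      unfolding V_def
    proof (rule image_eqI[of _ _ "(A$i$1, A$i$2, A$i$3)"])
      show "A $ i = (case (A$i$1, A$i$2, A$i$3) of (a, b, c) \<Rightarrow> vector [a, b, c])"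
        by (simp add: vec_eq_iff forall_3)
    qed (use integral_orthogonal_entries[OF that, of i] in blast)
    then show ?thesis
      unfolding W_def
    proof (intro image_eqI[of _ _ "(A$1, A$2, A$3)"])
      show "A = (case (A$1, A$2, A$3) of (a, b, c) \<Rightarrow> vector [a, b, c])"
        by (subst vec_eq_iff) (simp add: forall_3)
    qed blast
  qed
  ultimately show ?thesis by (meson finite_subset subsetI)
qed

lemma finite_Oh: "finite (plus_Z2c octahedral)"
  using finite_subset[OF Oh_integral finite_integral_orthogonal] .

text \<open>Entries lie in {-1, 0, 1}, so trace 2 would mean that two diagonal entries are 1 and the
  third is 0; the first two then use up their rows, and the column of the third vanishes.\<close>

lemma trace_integral_orthogonal:
  assumes "A \<in> integral_orthogonal"
  shows "trace A \<in> \<int>" "trace A \<noteq> 2"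
proof -
  show "trace A \<in> \<int>"
    using assms by (auto simp: trace_def sum_3 integral_orthogonal_def)
  show "trace A \<noteq> 2"
  proof
    assume tr: "trace A = 2"
    note e = integral_orthogonal_entries[OF assms]
    have c: "A \<in> carrier O3" using assms by (simp add: integral_orthogonal_def)
    note rc = orthogonal_matrix_row_col[OF c, of 1] orthogonal_matrix_row_col[OF c, of 2]
      orthogonal_matrix_row_col[OF c, of 3]
    have "A$1$1 + A$2$2 + A$3$3 = 2" using tr by (simp add: trace_def sum_3)
    then have "A$1$1 = 1 \<and> A$2$2 = 1 \<and> A$3$3 = 0 \<or> A$1$1 = 1 \<and> A$2$2 = 0 \<and> A$3$3 = 1 \<or>
        A$1$1 = 0 \<and> A$2$2 = 1 \<and> A$3$3 = 1"
      using e[of 1 1] e[of 2 2] e[of 3 3] by auto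
    then have "(A$1$1)\<^sup>2 = 1 \<and> (A$2$2)\<^sup>2 = 1 \<and> (A$3$3)\<^sup>2 = 0 \<or>
        (A$1$1)\<^sup>2 = 1 \<and> (A$2$2)\<^sup>2 = 0 \<and> (A$3$3)\<^sup>2 = 1 \<or>
        (A$1$1)\<^sup>2 = 0 \<and> (A$2$2)\<^sup>2 = 1 \<and> (A$3$3)\<^sup>2 = 1"
      by auto
    moreover have "(A$i$j)\<^sup>2 \<ge> 0" for i j by simp
    note this[of 1 2] this[of 1 3] this[of 2 1] this[of 2 3] this[of 3 1] this[of 3 2]
    ultimately show False using rc by (elim disjE conjE) linarith+
  qed
qed

text \<open>Crystallographic restriction: for an order d of at least 5, the trace
  1 + 2 cos (2 pi / d) lies strictly between 1 and 3, so it would have to be 2.\<close>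

lemma rot_e3_order_in_conj_Oh:
  assumes g: "g \<in> carrier O3" and d: "d > 0"
    and r: "rot e3 (2 * pi / real d) \<in> conj_set g (plus_Z2c octahedral)"
  shows "d \<in> {1, 2, 3, 4}"
proof (rule ccontr)
  assume "d \<notin> {1, 2, 3, 4}"
  with d have d5: "d \<ge> 5" by auto
  define x where "x = 2 * pi / real d"
  have x: "0 < x" "x < pi / 2"
    unfolding x_def using d5 by (simp_all add: field_simps)
  have "cos x > 0" using x by (intro cos_gt_zero) auto
  moreover have "cos x < 1" using cos_monotone_0_pi[of 0 x] x by auto
  moreover have "transpose g ** rot e3 x ** g \<in> integral_orthogonal"
    using r Oh_integral by (auto simp: mem_conj_set_iff[OF g] x_def)
  note trace_integral_orthogonal[OF this]
  moreover have "trace (transpose g ** rot e3 x ** g) = 1 + 2 * cos x"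
  proof -
    have "trace (transpose g ** rot e3 x ** g) = trace (g ** (transpose g ** rot e3 x))"
      by (rule trace_mul_sym)
    also have "\<dots> = trace (rot e3 x)"
      using transpose_O3(3)[OF g] by (simp add: matrix_mul_assoc)
    finally show ?thesis by (simp add: trace_def sum_3 rot_e3)
  qed
  ultimately obtain k :: int where "1 + 2 * cos x = of_int k" "k \<noteq> 2" "cos x > 0" "cos x < 1"
    by (auto elim!: Ints_cases)
  then have "1 < k" "k < 3" by linarith+
  with \<open>k \<noteq> 2\<close> show False by simp
qed

section \<open>Axes of the cube\<close>

text \<open>In the application the matrix h carries the vertical line to an axis of order f of the cube
  (to no axis if f = 1) and the plane with normal e1 to a mirror plane of the cube.  A rotation
  through 2 pi / k about that axis is excluded from the group as soon as one of its diagonal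
  entries, the one in \<open>ord\<close>, is not an integer; k = 2, 3, 4 are the only orders to test, by the
  crystallographic restriction.\<close>

lemma Dz_Int_axis:
  assumes h: "h \<in> carrier O3" and n: "n > 0" and f: "f > 0"
    and mir: "h ** mirror 0 ** transpose h \<in> plus_Z2c octahedral"
    and ax: "h ** rot e3 (2 * pi / real f) ** transpose h \<in> plus_Z2c octahedral"
    and ord: "\<And>k. k \<in> {2, 3, 4} \<Longrightarrow>
      (h$2$3)\<^sup>2 + cos (2 * pi / real k) * (1 - (h$2$3)\<^sup>2) \<in> \<int> \<Longrightarrow> k dvd f"
  shows "Zk n \<inter> conj_set (transpose h) (plus_Z2c octahedral) = Zk (gcd f n)"
    and "Dz n \<inter> conj_set (transpose h) (plus_Z2c octahedral) = Dz (gcd f n)"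
proof -
  define L where "L = conj_set (transpose h) (plus_Z2c octahedral)"
  note g = transpose_O3(1)[OF h]
  have L: "subgroup L O3" unfolding L_def by (rule subgroup_conj_set[OF g subgroup_Oh])
  have mem: "A \<in> L \<longleftrightarrow> h ** A ** transpose h \<in> plus_Z2c octahedral" for A
    by (simp add: L_def mem_conj_set_iff[OF g])
  obtain d where d: "d dvd n" "d > 0" "Zk n \<inter> L = Zk d" by (rule Zk_Int_subgroup[OF L n])
  then have rd: "rot e3 (2 * pi / real d) \<in> L" using rot_e3_in_Zk by blast
  then have "d \<in> {1, 2, 3, 4}"
    using rot_e3_order_in_conj_Oh[OF g d(2)] by (simp add: L_def)
  moreover have "d dvd f" if "d \<in> {2, 3, 4}"
  proof (rule ord[OF that])
    define A where "A = h ** rot e3 (2 * pi / real d) ** transpose h"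
    have "A \<in> integral_orthogonal" using rd Oh_integral by (auto simp: mem A_def)
    then have "A $ 2 $ 2 \<in> \<int>" by (auto simp: integral_orthogonal_def)
    moreover have "A $ 2 $ 2 = cos (2 * pi / real d) * ((h$2$1)\<^sup>2 + (h$2$2)\<^sup>2) + (h$2$3)\<^sup>2"
      by (simp add: A_def rot_e3 matrix_matrix_mult_def sum_3 transpose_def algebra_simps
          power2_eq_square)
    moreover have "(h$2$1)\<^sup>2 + (h$2$2)\<^sup>2 = 1 - (h$2$3)\<^sup>2"
      using orthogonal_matrix_row_col(1)[OF h, of 2] by simp
    ultimately show "(h$2$3)\<^sup>2 + cos (2 * pi / real d) * (1 - (h$2$3)\<^sup>2) \<in> \<int>"
      by (simp add: add.commute)
  qed
  ultimately have "d dvd f" by auto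
  moreover have "gcd f n dvd d"
  proof (rule rot_e3_in_Zk_imp_dvd)
    have "Zk f \<subseteq> L" using Zk_subset_subgroup[OF L] ax mem by blast
    then have "Zk (gcd f n) \<subseteq> Zk n \<inter> L"
      using Zk_mono[of "gcd f n" n] Zk_mono[of "gcd f n" f] n f by auto
    then show "rot e3 (2 * pi / real (gcd f n)) \<in> Zk d"
      using d rot_e3_in_Zk[of "gcd f n"] f by auto
  qed (use d f in auto)
  ultimately have dd: "d = gcd f n" using d by (simp add: dvd_antisym)
  with d show "Zk n \<inter> conj_set (transpose h) (plus_Z2c octahedral) = Zk (gcd f n)"
    by (simp add: L_def)
  have "Dz n \<inter> L = Zk d \<union> (\<lambda>A. mirror 0 ** A) ` Zk d"
    by (rule Dz_Int_subgroup_with_mirror[OF L n d(3), of 0]) (use n mir mem in auto)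
  also have "\<dots> = Dz d" unfolding Dz_def mirror_0 by (rule refl)
  finally show "Dz n \<inter> conj_set (transpose h) (plus_Z2c octahedral) = Dz (gcd f n)"
    unfolding L_def dd .
qed

text \<open>The reflection that exchanges the second and third coordinates.\<close>

abbreviation swap23 :: mat3 where
  "swap23 \<equiv> vector [vector [1, 0, 0], vector [0, 0, 1], vector [0, 1, 0]]"

lemma Oh_elements:
  "rot e3 (pi / 2) \<in> plus_Z2c octahedral" "- rot e1 pi \<in> plus_Z2c octahedral"
  "rot (e1 + e2 + e3) (2 * pi / 3) \<in> plus_Z2c octahedral"
  "swap23 \<in> plus_Z2c octahedral" "- swap23 \<in> plus_Z2c octahedral"
proof -
  define Q P where "Q = rot e3 (pi / 2)" and "P = rot (e1 + e2 + e3) (2 * pi / 3)"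
  have Q: "Q \<in> octahedral"
    unfolding octahedral_def Q_def by (rule generate.incl) (rule insertI1)
  have r1: "rot e1 pi \<in> octahedral"
    unfolding octahedral_def by (rule generate.incl) (rule insertI2, rule insertI1)
  have P: "P \<in> octahedral"
    unfolding octahedral_def P_def
    by (rule generate.incl) (rule insertI2, rule insertI2, rule insertI1)
  note grp = subgroup_octahedral[unfolded subgroup_O3_iff]
  \<comment> \<open>Conjugation by P turns Q into the quarter turn about e1; the half turn about e3 completes it
    to the half turn about e2 - e3.\<close>
  have "P ** Q ** transpose P ** (Q ** Q) \<in> octahedral" using P Q grp by blast
  moreover have "P ** Q ** transpose P ** (Q ** Q) = - swap23"
  proof -
    have "P ** Q = vector [vector [0, 0, 1], vector [0, - 1, 0], vector [1, 0, 0]]"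
      by (simp add: P_def Q_def rot_111 rot_e3 matrix_matrix_mult_def vec_eq_iff forall_3 sum_3)
    moreover have "transpose P = vector [vector [0, 1, 0], vector [0, 0, 1], vector [1, 0, 0]]"
      by (simp add: P_def rot_111 transpose_def vec_eq_iff forall_3)
    ultimately have "P ** Q ** transpose P
        = vector [vector [1, 0, 0], vector [0, 0, - 1], vector [0, 1, 0]]"
      by (simp add: matrix_matrix_mult_def vec_eq_iff forall_3 sum_3)
    moreover have "Q ** Q = rot e3 pi" by (simp add: Q_def rot_e3_mult)
    ultimately show ?thesis
      by (simp add: rot_e3 matrix_matrix_mult_def vec_eq_iff forall_3 sum_3)
  qed
  ultimately have s: "- swap23 \<in> octahedral" by simp
  then have "- (- swap23) \<in> plus_Z2c octahedral" unfolding plus_Z2c_def by blast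
  then show "swap23 \<in> plus_Z2c octahedral" by (simp only: minus_minus)
  show "rot e3 (pi / 2) \<in> plus_Z2c octahedral"
    using Q unfolding plus_Z2c_def Q_def by (rule UnI1)
  show "- rot e1 pi \<in> plus_Z2c octahedral"
    using r1 unfolding plus_Z2c_def by (intro UnI2 imageI)
  show "rot (e1 + e2 + e3) (2 * pi / 3) \<in> plus_Z2c octahedral"
    using P unfolding plus_Z2c_def P_def by (rule UnI1)
  show "- swap23 \<in> plus_Z2c octahedral"
    using s unfolding plus_Z2c_def by (rule UnI1)
qed

lemma cos_2pi_div: "cos (2 * pi / 2) = -1" "cos (2 * pi / 3) = -1/2" "cos (2 * pi / 4) = 0"
  using cos_120 by auto

lemma conj_eq_if_intertwines:
  assumes "h \<in> carrier O3" "h ** X = Y ** h"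
  shows "h ** X ** transpose h = Y"
  using assms transpose_O3(3)[OF assms(1)] by (simp flip: matrix_mul_assoc)

text \<open>The vertical line becomes a fourfold, threefold or twofold axis of the cube, or, for f = 1, a
  line in a mirror plane that is not an axis.  In each case the third column of h directs that line
  and the first column is normal to a mirror plane containing it.  The number w is the square of
  the second coordinate of the direction; by the cosines above, the diagonal entry that decides
  about the order k is a proper fraction for each k that has to be excluded.\<close>

lemma Dz_Int_conj_Oh_realised:
  assumes n: "n > 0" and f: "f \<in> {1, 2, 3, 4}"
  obtains g where "g \<in> carrier O3"
    and "Zk n \<inter> conj_set g (plus_Z2c octahedral) = Zk (gcd f n)"
    and "Dz n \<inter> conj_set g (plus_Z2c octahedral) = Dz (gcd f n)"
proof -
  note calc = O3_def orthogonal_matrix_def matrix_matrix_mult_def transpose_def mat_def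
    mirror_matrix rot_e3 rot_e1 rot_111 vec_eq_iff forall_3 sum_3
  have mir0: "mirror 0 \<in> plus_Z2c octahedral" using Oh_elements(2) by (simp add: mirror_0)
  note realised = that
  have axis: thesis
    if h: "h \<in> carrier O3"
      and mir: "h ** mirror 0 = S ** h" "S \<in> plus_Z2c octahedral"
      and ax: "h ** rot e3 (2 * pi / real f) = R ** h" "R \<in> plus_Z2c octahedral"
      and w: "(h$2$3)\<^sup>2 = w"
      and ord: "\<And>k. k \<in> {2, 3, 4} \<Longrightarrow> \<not> k dvd f \<Longrightarrow>
        0 < \<bar>w + cos (2 * pi / real k) * (1 - w)\<bar> \<and>
        \<bar>w + cos (2 * pi / real k) * (1 - w)\<bar> < 1"
    for h S R w
  proof (rule realised[OF transpose_O3(1)[OF h]])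
    have *: "k dvd f" if k: "k \<in> {2, 3, 4}"
      and "(h$2$3)\<^sup>2 + cos (2 * pi / real k) * (1 - (h$2$3)\<^sup>2) \<in> \<int>" for k
      using ord[OF k] Ints_nonzero_abs_ge1[OF that(2)] unfolding w by force
    have M: "h ** mirror 0 ** transpose h \<in> plus_Z2c octahedral"
      using mir(2) unfolding conj_eq_if_intertwines[OF h mir(1)] .
    have A: "h ** rot e3 (2 * pi / real f) ** transpose h \<in> plus_Z2c octahedral"
      using ax(2) unfolding conj_eq_if_intertwines[OF h ax(1)] .
    have f0: "f > 0" using f by auto
    show "Zk n \<inter> conj_set (transpose h) (plus_Z2c octahedral) = Zk (gcd f n)"
      by (rule Dz_Int_axis(1)[OF h n f0 M A *])
    show "Dz n \<inter> conj_set (transpose h) (plus_Z2c octahedral) = Dz (gcd f n)"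
      by (rule Dz_Int_axis(2)[OF h n f0 M A *])
  qed
  consider "f = 1" | "f = 2" | "f = 3" | "f = 4" using f by auto
  then show thesis
  proof cases
    case 1
    \<comment> \<open>A direction in the plane of e2 and e3 on no symmetry axis, rational by the triple 3, 4, 5.\<close>
    define h :: mat3
      where "h = vector [vector [1, 0, 0], vector [0, 4/5, 3/5], vector [0, - (3/5), 4/5]]"
    show thesis
    proof (rule axis[of h "mirror 0" "mat 1"])
      show "mat 1 \<in> plus_Z2c octahedral" using subgroup_Oh subgroup_O3_iff by blast
      show "h ** rot e3 (2 * pi / real f) = mat 1 ** h" by (simp add: 1 rot_e3_2pi)
      show "h \<in> carrier O3" "h ** mirror 0 = mirror 0 ** h" by (simp_all add: h_def calc)
      show "(h$2$3)\<^sup>2 = 9/25" by (simp add: h_def power2_eq_square)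
      show "0 < \<bar>9/25 + cos (2 * pi / real k) * (1 - 9/25)\<bar> \<and>
        \<bar>9/25 + cos (2 * pi / real k) * (1 - 9/25)\<bar> < 1"
        if "k \<in> {2, 3, 4}" for k
        using that cos_2pi_div by auto
    qed (rule mir0)
  next
    case 2
    define s where "s = sqrt (1/2)"
    have s: "s * s = 1/2" by (simp add: s_def)
    \<comment> \<open>The twofold axis directed by e2 - e3, in the plane with normal e1.\<close>
    define h :: mat3
      where "h = vector [vector [1, 0, 0], vector [0, s, s], vector [0, s, - s]]"
    show thesis
    proof (rule axis[of h "mirror 0" "- swap23"])
      show "h \<in> carrier O3" "h ** mirror 0 = mirror 0 ** h"
        "h ** rot e3 (2 * pi / real f) = - swap23 ** h"
        by (simp_all add: h_def calc s 2)
      show "(h$2$3)\<^sup>2 = 1/2" by (simp add: h_def power2_eq_square s)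
      show "0 < \<bar>1/2 + cos (2 * pi / real k) * (1 - 1/2)\<bar> \<and>
        \<bar>1/2 + cos (2 * pi / real k) * (1 - 1/2)\<bar> < 1"
        if "k \<in> {2, 3, 4}" "\<not> k dvd f" for k
        using that 2 cos_2pi_div by auto
    qed (rule mir0 Oh_elements)+
  next
    case 3
    define a b c where "a = sqrt (1/2)" and "b = sqrt (1/3)" and "c = sqrt (1/6)"
    have sq: "a * a = 1/2" "b * b = 1/3" "c * c = 1/6" by (simp_all add: a_def b_def c_def)
    have ca: "c * sqrt 3 = a" by (simp add: a_def c_def flip: real_sqrt_mult)
    have ac: "a * sqrt 3 = 3 * c" unfolding ca[symmetric] by simp
    \<comment> \<open>The threefold axis directed by e1 + e2 + e3, in the plane with normal e2 - e3.\<close>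
    define h :: mat3
      where "h = vector [vector [0, - (2 * c), b], vector [a, c, b], vector [- a, c, b]]"
    show thesis
    proof (rule axis[of h swap23 "rot (e1 + e2 + e3) (2 * pi / 3)"])
      show "h \<in> carrier O3"
        by (simp add: h_def O3_def orthogonal_matrix matrix_matrix_mult_def transpose_def
            mat_def vec_eq_iff forall_3 sum_3 sq)
      show "h ** mirror 0 = swap23 ** h" by (simp add: h_def calc)
      have cs: "cos (2 * pi / real f) = - 1 / 2" "sin (2 * pi / real f) = sqrt 3 / 2"
        using 3 cos_120 sin_120 by auto
      show "h ** rot e3 (2 * pi / real f) = rot (e1 + e2 + e3) (2 * pi / 3) ** h"
        unfolding rot_111 rot_e3 cs
        by (simp add: h_def matrix_matrix_mult_def vec_eq_iff forall_3 sum_3 ca ac)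
      show "(h$2$3)\<^sup>2 = 1/3" by (simp add: h_def power2_eq_square sq)
      show "0 < \<bar>1/3 + cos (2 * pi / real k) * (1 - 1/3)\<bar> \<and>
        \<bar>1/3 + cos (2 * pi / real k) * (1 - 1/3)\<bar> < 1"
        if "k \<in> {2, 3, 4}" "\<not> k dvd f" for k
        using that 3 cos_2pi_div by auto
    qed (rule Oh_elements)+
  next
    case 4
    show thesis
    proof (rule axis[of "mat 1" "mirror 0" "rot e3 (pi / 2)"])
      show "(mat 1 :: mat3) \<in> carrier O3" by (simp add: O3_def orthogonal_matrix_id)
      show "mat 1 ** rot e3 (2 * pi / real f) = rot e3 (pi / 2) ** mat 1" by (simp add: 4)
      show "((mat 1 :: mat3)$2$3)\<^sup>2 = 0" by (simp add: mat_def)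
      show "0 < \<bar>0 + cos (2 * pi / real k) * (1 - 0)\<bar> \<and>
        \<bar>0 + cos (2 * pi / real k) * (1 - 0)\<bar> < 1"
        if "k \<in> {2, 3, 4}" "\<not> k dvd f" for k
        using that 4 cos_2pi_div by auto
    qed (simp_all add: mir0 Oh_elements)
  qed
qed

section \<open>The clips operation\<close>

lemma conj_class_Dz_Int_conj_Oh:
  assumes g: "g \<in> carrier O3" and n: "n > 0"
  shows "\<exists>f\<in>{1, 2, 3, 4}. conj_class (Dz n \<inter> conj_set g (plus_Z2c octahedral))
      \<in> {conj_class (Zk (gcd f n)), conj_class (Dz (gcd f n))}"
proof -
  let ?L = "conj_set g (plus_Z2c octahedral)"
  have L: "subgroup ?L O3" by (rule subgroup_conj_set[OF g subgroup_Oh])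
  obtain d where d: "d dvd n" "d > 0" "Zk n \<inter> ?L = Zk d" by (rule Zk_Int_subgroup[OF L n])
  then have "d \<in> {1, 2, 3, 4}"
    using rot_e3_order_in_conj_Oh[OF g d(2)] rot_e3_in_Zk[of d] by blast
  moreover have "d = gcd d n" using d by (simp add: gcd_proj1_if_dvd)
  moreover have "conj_class (Dz n \<inter> ?L) \<in> {conj_class (Zk d), conj_class (Dz d)}"
    using Dz_Int_subgroup_cases[OF L n d(3)] conj_class_conj_set[OF rot_e3_carrier] by auto
  ultimately show ?thesis by metis
qed

text \<open>The theorem in uniform form: f = 1 accounts for the trivial group and the group generated by
  one reflection, because \<^term>\<open>Zk 1\<close> and \<^term>\<open>Dz 1\<close> are those groups up to conjugacy.\<close>

lemma clips_Dz_Oh: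
  assumes n: "n > 0"
  shows "conj_class (Dz n) \<circledcirc> conj_class (plus_Z2c octahedral)
    = (\<Union>f\<in>{1, 2, 3, 4}. {conj_class (Zk (gcd f n)), conj_class (Dz (gcd f n))})"
    (is "?C = ?R")
proof (rule equalityI)
  show "?C \<subseteq> ?R"
  proof
    fix X assume "X \<in> ?C"
    then obtain g where g: "g \<in> carrier O3"
      "X = conj_class (Dz n \<inter> conj_set g (plus_Z2c octahedral))"
      unfolding clips_conj_class by blast
    show "X \<in> ?R" unfolding g(2) UN_iff by (rule conj_class_Dz_Int_conj_Oh[OF g(1) n])
  qed
  have "conj_class (Zk (gcd f n)) \<in> ?C \<and> conj_class (Dz (gcd f n)) \<in> ?C"
    if f: "f \<in> {1, 2, 3, 4}" for f
  proof -
    obtain g where g: "g \<in> carrier O3"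
      "Zk n \<inter> conj_set g (plus_Z2c octahedral) = Zk (gcd f n)"
      "Dz n \<inter> conj_set g (plus_Z2c octahedral) = Dz (gcd f n)"
      by (rule Dz_Int_conj_Oh_realised[OF n f])
    have "finite (conj_set g (plus_Z2c octahedral))"
      using finite_Oh by (simp add: conj_set_def)
    then obtain a where
      "Dz n \<inter> conj_set (rot e3 a) (conj_set g (plus_Z2c octahedral)) = Zk (gcd f n)"
      using Dz_Int_turned_subgroup[OF _ n] g(2) by metis
    then have "Zk (gcd f n) = Dz n \<inter> conj_set (rot e3 a ** g) (plus_Z2c octahedral)"
      by (simp add: conj_set_mult rot_e3_carrier g)
    moreover have "rot e3 a ** g \<in> carrier O3"
      using rot_e3_carrier[of a] g by (auto simp: O3_def orthogonal_matrix_mul)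
    ultimately show ?thesis
      unfolding clips_conj_class mem_Collect_eq
      by (intro conjI exI[of _ "rot e3 a ** g"] exI[of _ g]) (simp_all only: g)
  qed
  then show "?R \<subseteq> ?C" by blast
qed

theorem lemma4p10:
  fixes n d2 d3 d4 :: nat
  assumes "n \<ge> 2"
    and "d2 = gcd 2 n" and "d3 = gcd 3 n" and "d4 = gcd 4 n"
  shows "conj_class (Dz n) \<circledcirc> conj_class (plus_Z2c octahedral) =
    {conj_class trivial_grp, conj_class (Zk d2), conj_class (Zk d3), conj_class (Zk d4),
     conj_class Z2minus, conj_class (Dz d2), conj_class (Dz d3), conj_class (Dz d4)}"
proof -
  have "n > 0" using assms(1) by simp
  have "conj_class (Zk (gcd 1 n)) = conj_class trivial_grp"
    "conj_class (Dz (gcd 1 n)) = conj_class Z2minus"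
    using Zk_1 conj_class_Dz_1 by simp_all
  then show ?thesis
    unfolding clips_Dz_Oh[OF \<open>n > 0\<close>] assms(2-4) by auto
qed

end
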